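(* Consider the Austere Deletion Channel with $1$-deletion probability $p_1$ and let $q_1=1-p_1$, with $q_1=\Omega(\sqrt{k^{-1}\log n})$. Then $m=\exp\big(O((k/q_1)^{1/3}\log^{2/3} n)\big)$ traces suffice to reconstruct, with high probability, an unknown string $x\in\{0,1\}^n$ having at most $k$ entries equal to $1$.
   Context: The Austere Deletion Channel acts on $x\in\{0,1\}^n$ as follows: all but exactly one $0$ of $x$ are deleted, where the retained $0$ is chosen uniformly at random among the $0$s of $x$, and each $1$ of $x$ is deleted independently with probability $p_1$; the output (a trace) is the subsequence of surviving symbols, with deletion locations not revealed. "With high probability" means with probability at least $1-o(1)$ as $n\to\infty$. *)

theory Defs
  imports "HOL-Probability.Probability"
begin

text \<open>
  Binary strings are lists of type \<^typ>\<open>bool list\<close>, with \<^term>\<open>True\<close> standing for the symbol 1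
  and \<^term>\<open>False\<close> for the symbol 0.
\<close>

definition one_positions :: "bool list \<Rightarrow> nat set" where
  "one_positions x = {i. i < length x \<and> x ! i}"

definition zero_positions :: "bool list \<Rightarrow> nat set" where
  "zero_positions x = {i. i < length x \<and> \<not> x ! i}"

text \<open>
  If the string has no 0 there is nothing to choose from; by convention no 0 is then retained,
  so that the channel is defined on every string.
\<close>

definition retained_zeros :: "bool list \<Rightarrow> nat set pmf" where
  "retained_zeros x =
     (if zero_positions x = {} then return_pmf {}
      else map_pmf (\<lambda>z. {z}) (pmf_of_set (zero_positions x)))"

definition retained_ones :: "real \<Rightarrow> bool list \<Rightarrow> nat set pmf" where
  "retained_ones p x =
     map_pmf (\<lambda>keep. {i \<in> one_positions x. keep i})
       (Pi_pmf (one_positions x) False (\<lambda>_. bernoulli_pmf (1 - p)))"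

text \<open>The parameter \<^term>\<open>p\<close> is the probability that a given 1 is deleted.\<close>

definition austere_channel :: "real \<Rightarrow> bool list \<Rightarrow> bool list pmf" where
  "austere_channel p x =
     map_pmf (\<lambda>(Z, S). nths x (Z \<union> S)) (pair_pmf (retained_zeros x) (retained_ones p x))"

definition austere_traces :: "nat \<Rightarrow> real \<Rightarrow> bool list \<Rightarrow> bool list list pmf" where
  "austere_traces m p x = replicate_pmf m (austere_channel p x)"

end

theory Submission
  imports Defs "HOL-Complex_Analysis.Conformal_Mappings" "HOL-Real_Asymp.Real_Asymp"
begin

text \<open>If \<open>a\<^sub>z\<close> counts the 1s before the 0 at \<open>z\<close>, the number \<open>A\<close> of leading 1s of a trace satisfies
  \<open>E (s ^ A) = average over z of u ^ a\<^sub>z\<close> with \<open>u = p + q s\<close>. For two strings with equally many 1s these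
  averages differ by a nonzero integer polynomial in \<open>u\<close> divided by the number of 0s, and such a
  polynomial cannot be small on a whole arc \<open>u = cis \<theta>\<close>, \<open>\<bar>\<theta>\<bar> \<le> \<pi> / M\<close>. Strings with different numbers
  of 1s are told apart by the mean number of 1s in a trace. Either way the trace distributions are
  far enough apart in total variation for Hoeffding's inequality to beat a union bound over all pairs
  of strings.\<close>

section \<open>Identifying a distribution from samples\<close>

text \<open>Replacing each sample by its indicator of \<open>S\<close> gives independent Bernoulli
  trials, so tail bounds for binomial laws apply to empirical frequencies.\<close>

lemma map_count_replicate_pmf:
  "map_pmf (\<lambda>ts. length (filter (\<lambda>t. t \<in> S) ts)) (replicate_pmf m P) =
     binomial_pmf m (measure_pmf.prob P S)"
proof -
  have "map_pmf (\<lambda>ts. length (filter (\<lambda>t. t \<in> S) ts)) (replicate_pmf m P) =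
      map_pmf (length \<circ> filter id) (map_pmf (map (\<lambda>t. t \<in> S)) (replicate_pmf m P))"
    by (simp add: pmf.map_comp o_def filter_map)
  also have "map_pmf (map (\<lambda>t. t \<in> S)) (replicate_pmf m P) = replicate_pmf m (map_pmf (\<lambda>t. t \<in> S) P)"
  proof (induction m)
    case (Suc m)
    show ?case
      by (simp add: map_bind_pmf bind_map_pmf flip: Suc.IH)
  qed simp
  also have "map_pmf (\<lambda>t. t \<in> S) P = bernoulli_pmf (measure_pmf.prob P S)"
  proof (rule pmf_eqI)
    fix b
    have "(\<lambda>t. t \<in> S) -` {True} = S" "(\<lambda>t. t \<in> S) -` {False} = UNIV - S"
      by auto
    then show "pmf (map_pmf (\<lambda>t. t \<in> S) P) b = pmf (bernoulli_pmf (measure_pmf.prob P S)) b"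
      using measure_pmf.prob_compl[of S P]
      by (cases b) (simp_all add: pmf_map measure_pmf.prob_le_1)
  qed
  finally show ?thesis
    by (subst binomial_pmf_altdef) (simp_all add: measure_pmf.prob_le_1 o_def id_def)
qed

lemma prob_empirical_frequency_deviates:
  assumes "m > 0" "\<epsilon> \<ge> 0"
  shows "measure_pmf.prob (replicate_pmf m P)
           {ts. \<bar>length (filter (\<lambda>t. t \<in> S) ts) / real m - measure_pmf.prob P S\<bar> \<ge> \<epsilon>}
         \<le> 2 * exp (-2 * real m * \<epsilon>\<^sup>2)"
proof -
  interpret binomial_distribution m "measure_pmf.prob P S"
    by unfold_locales (simp add: measure_pmf.prob_le_1)
  show ?thesis
    \<comment> \<open>Hoeffding's inequality for the binomial law.\<close>
    using prob_abs_ge'[OF assms]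
    by (simp flip: map_count_replicate_pmf[of S m P] add: vimage_def)
qed

text \<open>Accept a candidate if every pairwise separating set has empirical frequency within
  \<open>\<epsilon> / 2\<close> of its predicted probability. Two accepted candidates would
  contradict the gap on their own separating set, and the true one is rejected only if one of at
  most \<open>card X ^ 2\<close> frequencies deviates.\<close>

lemma exists_identification_from_samples:
  fixes P :: "'x \<Rightarrow> 't pmf"
  assumes fin: "finite X" and m: "m > 0" and \<epsilon>: "\<epsilon> > 0"
    and sep: "\<And>x y. x \<in> X \<Longrightarrow> y \<in> X \<Longrightarrow> x \<noteq> y \<Longrightarrow>
           \<exists>S. measure_pmf.prob (P x) S - measure_pmf.prob (P y) S \<ge> \<epsilon>"
  shows "\<exists>g. \<forall>x\<in>X. measure_pmf.prob (replicate_pmf m (P x)) {ts. g ts = x}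
                  \<ge> 1 - 2 * real (card X)^2 * exp (- real m * \<epsilon>\<^sup>2 / 2)"
proof -
  obtain S where S: "\<And>x y. x \<in> X \<Longrightarrow> y \<in> X \<Longrightarrow> x \<noteq> y \<Longrightarrow>
      measure_pmf.prob (P x) (S x y) - measure_pmf.prob (P y) (S x y) \<ge> \<epsilon>"
    using sep by metis
  define freq where "freq A ts = length (filter (\<lambda>t. t \<in> A) ts) / real m" for A and ts :: "'t list"
  define dev where
    "dev x A = {ts. \<bar>freq A ts - measure_pmf.prob (P x) A\<bar> \<ge> \<epsilon> / 2}" for x A
  define good where "good ts x \<longleftrightarrow> x \<in> X \<and> (\<forall>a\<in>X. \<forall>b\<in>X. ts \<notin> dev x (S a b))" for ts x
  define g where "g ts = (SOME x. good ts x)" for ts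
  have unique: "x = y" if "good ts x" "good ts y" for ts x y
  proof (rule ccontr)
    assume "x \<noteq> y"
    moreover have "x \<in> X" "y \<in> X" "ts \<notin> dev x (S x y)" "ts \<notin> dev y (S x y)"
      using that by (auto simp: good_def)
    ultimately show False
      using S[of x y] unfolding dev_def by (auto simp: abs_if split: if_splits)
  qed
  have g: "g ts = x" if "good ts x" for ts x
    unfolding g_def using unique that by (metis someI)
  have "measure_pmf.prob (replicate_pmf m (P x)) {ts. g ts = x}
          \<ge> 1 - 2 * real (card X)^2 * exp (- real m * \<epsilon>\<^sup>2 / 2)" if x: "x \<in> X" for x
  proof -
    let ?M = "measure_pmf (replicate_pmf m (P x))"
    have "measure ?M (- {ts. g ts = x}) \<le> measure ?M (\<Union>(a,b)\<in>X\<times>X. dev x (S a b))"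
      using g x by (intro measure_pmf.finite_measure_mono) (auto simp: good_def)
    also have "\<dots> \<le> (\<Sum>(a,b)\<in>X\<times>X. measure ?M (dev x (S a b)))"
      using measure_pmf.finite_measure_subadditive_finite[of "X \<times> X" "\<lambda>(a,b). dev x (S a b)"
          "replicate_pmf m (P x)"] fin
      by (simp add: case_prod_unfold)
    also have "\<dots> \<le> (\<Sum>(a,b)\<in>X\<times>X. 2 * exp (- real m * \<epsilon>\<^sup>2 / 2))"
    proof (rule sum_mono, clarify)
      fix a b
      show "measure ?M (dev x (S a b)) \<le> 2 * exp (- real m * \<epsilon>\<^sup>2 / 2)"
        using prob_empirical_frequency_deviates[of m "\<epsilon>/2" "P x" "S a b"] m \<epsilon>
        by (simp add: dev_def freq_def power_divide)
    qed
    also have "\<dots> = 2 * real (card X)^2 * exp (- real m * \<epsilon>\<^sup>2 / 2)"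
      by (simp add: card_cartesian_product power2_eq_square)
    finally show ?thesis
      using measure_pmf.prob_compl[of "{ts. g ts = x}" "replicate_pmf m (P x)"]
      by (simp add: Compl_eq_Diff_UNIV)
  qed
  then show ?thesis
    by blast
qed

text \<open>Cauchy--Schwarz with \<open>\<bar>p - q\<bar> \<le> sqrt (p + q) * sqrt \<bar>p - q\<bar>\<close>: only the second moments
  of the unbounded statistic enter, so no truncation is needed.\<close>

lemma separating_set_from_expectation_gap:
  fixes f :: "'t \<Rightarrow> complex"
  assumes "finite (set_pmf P)" "finite (set_pmf Q)"
  shows "\<exists>S. (norm (measure_pmf.expectation P f - measure_pmf.expectation Q f))\<^sup>2 \<le>
     2 * (measure_pmf.expectation P (\<lambda>t. (norm (f t))\<^sup>2) + measure_pmf.expectation Q (\<lambda>t. (norm (f t))\<^sup>2))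
       * (measure_pmf.prob P S - measure_pmf.prob Q S)"
proof -
  define A where "A = set_pmf P \<union> set_pmf Q"
  \<comment> \<open>This set maximises the difference of the two probabilities; the maximum is half
    the L1 distance \<open>V\<close>.\<close>
  define S where "S = {t\<in>A. pmf P t > pmf Q t}"
  define V where "V = (\<Sum>t\<in>A. \<bar>pmf P t - pmf Q t\<bar>)"
  have fin: "finite A"
    using assms by (simp add: A_def)
  have E: "measure_pmf.expectation P h = (\<Sum>t\<in>A. pmf P t *\<^sub>R h t)"
          "measure_pmf.expectation Q h = (\<Sum>t\<in>A. pmf Q t *\<^sub>R h t)"
    for h :: "'t \<Rightarrow> 'v :: {banach, second_countable_topology}"
    using fin by (auto intro!: integral_measure_pmf simp: A_def)
  have V: "V = 2 * (measure_pmf.prob P S - measure_pmf.prob Q S)"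
  proof -
    have "(\<Sum>t\<in>A. pmf P t) = 1" "(\<Sum>t\<in>A. pmf Q t) = 1"
      using fin by (auto intro!: sum_pmf_eq_1 simp: A_def)
    then have 0: "(\<Sum>t\<in>A. pmf P t - pmf Q t) = 0"
      by (simp add: sum_subtractf)
    \<comment> \<open>Uses |a| = 2 max(a, 0) - a; the subtracted differences sum to 0.\<close>
    have "V = (\<Sum>t\<in>A. 2 * (if t \<in> S then pmf P t - pmf Q t else 0) - (pmf P t - pmf Q t))"
      unfolding V_def by (intro sum.cong) (auto simp: S_def)
    also have "\<dots> = 2 * (\<Sum>t\<in>A. if t \<in> S then pmf P t - pmf Q t else 0)"
      using 0 by (simp add: sum_subtractf sum_distrib_left)
    also have "(\<Sum>t\<in>A. if t \<in> S then pmf P t - pmf Q t else 0) = (\<Sum>t\<in>S. pmf P t - pmf Q t)"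
      using fin by (intro sum.mono_neutral_cong_right) (auto simp: S_def)
    also have "\<dots> = measure_pmf.prob P S - measure_pmf.prob Q S"
      using fin by (simp add: measure_measure_pmf_finite S_def sum_subtractf)
    finally show ?thesis .
  qed
  have "norm (measure_pmf.expectation P f - measure_pmf.expectation Q f)
      = norm (\<Sum>t\<in>A. (pmf P t - pmf Q t) *\<^sub>R f t)"
    unfolding E by (simp add: sum_subtractf scaleR_diff_left)
  also have "\<dots> \<le> (\<Sum>t\<in>A. \<bar>pmf P t - pmf Q t\<bar> * norm (f t))"
    by (rule order.trans[OF norm_sum]) simp
  also have "\<dots> = (\<Sum>t\<in>A. sqrt \<bar>pmf P t - pmf Q t\<bar> * (sqrt \<bar>pmf P t - pmf Q t\<bar> * norm (f t)))"
    by (simp flip: mult.assoc)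
  finally have "(norm (measure_pmf.expectation P f - measure_pmf.expectation Q f))\<^sup>2
      \<le> (\<Sum>t\<in>A. sqrt \<bar>pmf P t - pmf Q t\<bar> * (sqrt \<bar>pmf P t - pmf Q t\<bar> * norm (f t)))\<^sup>2"
    by (intro power_mono) auto
  also have "\<dots> \<le> (\<Sum>t\<in>A. (sqrt \<bar>pmf P t - pmf Q t\<bar>)\<^sup>2) *
      (\<Sum>t\<in>A. (sqrt \<bar>pmf P t - pmf Q t\<bar> * norm (f t))\<^sup>2)"
    by (rule Cauchy_Schwarz_ineq_sum)
  also have "\<dots> = V * (\<Sum>t\<in>A. \<bar>pmf P t - pmf Q t\<bar> * (norm (f t))\<^sup>2)"
    by (simp add: V_def power_mult_distrib)
  also have "\<dots> \<le> V * (\<Sum>t\<in>A. (pmf P t + pmf Q t) * (norm (f t))\<^sup>2)"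
    unfolding V_def
    by (intro mult_left_mono sum_mono mult_right_mono sum_nonneg)
       (auto simp: abs_if not_less intro: order.trans[OF _ pmf_nonneg])
  also have "\<dots> = V * (measure_pmf.expectation P (\<lambda>t. (norm (f t))\<^sup>2) +
      measure_pmf.expectation Q (\<lambda>t. (norm (f t))\<^sup>2))"
    unfolding E by (simp add: sum.distrib distrib_right)
  finally show ?thesis
    unfolding V by (intro exI[of _ S]) (simp add: algebra_simps)
qed

section \<open>Integer polynomials on short arcs of the unit circle\<close>

text \<open>Supplies a lower bound at the centre of the disc: the constant term of \<open>E\<close>
  is the lowest nonzero coefficient of \<open>D\<close>, a nonzero integer. Removing a power of the
  variable changes no modulus on the unit circle.\<close>

lemma integer_poly_factor_at_0:
  fixes D :: "complex poly"
  assumes "D \<noteq> 0" and ints: "\<And>i. coeff D i \<in> \<int>"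
  obtains r E where "D = monom 1 r * E" "norm (poly E 0) \<ge> 1"
proof -
  obtain E where E: "D = [:- 0, 1:] ^ order 0 D * E" "\<not> [:- 0, 1:] dvd E"
    using order_decomp[OF assms(1)] by blast
  have D: "D = monom 1 (order 0 D) * E"
    using E(1) by (simp add: monom_altdef)
  have "poly E 0 \<noteq> 0"
    using E(2) by (simp add: poly_eq_0_iff_dvd)
  moreover have "poly E 0 \<in> \<int>"
    using ints[of "order 0 D"] coeff_monom_mult[of 1 "order 0 D" E "order 0 D"]
    by (simp flip: D add: poly_0_coeff_0)
  ultimately have "norm (poly E 0) \<ge> 1"
    by (elim Ints_cases) simp
  then show ?thesis
    using that D by blast
qed

text \<open>Rounding the argument to the nearest multiple of \<open>2 * pi / M\<close> leaves an
  error of at most half that spacing.\<close>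

lemma unit_circle_covered_by_rotated_arcs:
  assumes "M > 0" "norm (w::complex) = 1"
  shows "\<exists>j<M. \<exists>\<theta>. \<bar>\<theta>\<bar> \<le> pi / real M \<and> w * cis (2 * pi * real j / real M) = cis \<theta>"
proof -
  define t where "t = round (Arg w * real M / (2 * pi))"
  define \<theta> where "\<theta> = Arg w - 2 * pi * real_of_int t / real M"
  \<comment> \<open>Rotating back by \<open>t\<close> steps agrees with rotating forward by
    \<open>- t\<close> reduced mod \<open>M\<close>, an index below \<open>M\<close>.\<close>
  define j where "j = nat ((- t) mod int M)"
  have w: "w = cis (Arg w)"
    using assms(2) by (metis cis_Arg norm_zero sgn_div_norm div_by_1 inverse_1 scaleR_one zero_neq_one)
  have "\<bar>\<theta>\<bar> = 2 * pi / real M * \<bar>real_of_int t - Arg w * real M / (2 * pi)\<bar>"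
  proof -
    have "\<theta> = - (2 * pi / real M * (real_of_int t - Arg w * real M / (2 * pi)))"
      using assms(1) by (simp add: \<theta>_def field_simps)
    then show ?thesis
      by (simp add: abs_mult)
  qed
  also have "\<dots> \<le> 2 * pi / real M * (1 / 2)"
    unfolding t_def by (intro mult_left_mono of_int_round_abs_le) auto
  finally have \<theta>: "\<bar>\<theta>\<bar> \<le> pi / real M"
    by simp
  have "int j = - t - int M * ((- t) div int M)"
    using assms(1) by (simp add: j_def minus_mult_div_eq_mod)
  then have j: "real j = - real_of_int t - real M * real_of_int ((- t) div int M)"
    by (metis of_int_of_nat_eq of_int_diff of_int_minus of_int_mult)
  have "2 * pi * real j / real M =
      - (2 * pi * real_of_int t / real M) + 2 * pi * real_of_int (- ((- t) div int M))"
    using assms(1) unfolding j by (simp add: field_simps)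
  then have "cis (2 * pi * real j / real M) = cis (- (2 * pi * real_of_int t / real M))"
    by (metis cis_mult cis_multiple_2pi Ints_of_int mult.right_neutral)
  then have "w * cis (2 * pi * real j / real M) = cis \<theta>"
    by (subst w) (simp add: cis_mult \<theta>_def)
  moreover have "j < M"
    using assms(1) by (simp add: j_def nat_less_iff)
  ultimately show ?thesis
    using \<theta> by blast
qed

text \<open>On the unit circle the product of \<open>M\<close> equally spaced rotations of the polynomial always has
  one factor evaluated on the arc; the maximum modulus principle compares with its value at 0.\<close>

lemma integer_poly_large_on_arc:
  fixes D :: "complex poly"
  assumes "D \<noteq> 0" and ints: "\<And>i. coeff D i \<in> \<int>" and M: "M > 0"
    and B: "\<And>u. norm u = 1 \<Longrightarrow> norm (poly D u) \<le> B"
  shows "\<exists>\<theta>. \<bar>\<theta>\<bar> \<le> pi / real M \<and> 1 \<le> norm (poly D (cis \<theta>)) * B ^ (M - 1)"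
proof -
  obtain r E where E: "D = monom 1 r * E" "norm (poly E 0) \<ge> 1"
    using integer_poly_factor_at_0[OF assms(1,2)] by blast
  have norm_E: "norm (poly E u) = norm (poly D u)" if "norm u = 1" for u
    using that by (simp add: E(1) poly_monom norm_mult norm_power)
  have "B \<ge> 0"
    using B[of 1] norm_ge_zero[of "poly D 1"] by (meson norm_one order_trans)
  \<comment> \<open>By compactness one \<theta> maximises the modulus on the arc; it bounds the arc
    factor for every boundary point \<open>w\<close> at once.\<close>
  have "continuous_on {- (pi / M)..pi / M} (\<lambda>\<theta>. norm (poly E (cis \<theta>)))"
    by (intro continuous_intros)
  then obtain \<theta> where \<theta>: "\<theta> \<in> {- (pi / M)..pi / M}"
    and max: "\<And>\<theta>'. \<theta>' \<in> {- (pi / M)..pi / M} \<Longrightarrow> norm (poly E (cis \<theta>')) \<le> norm (poly E (cis \<theta>))"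
    using continuous_attains_sup[of "{- (pi / M)..pi / M}" "\<lambda>\<theta>. norm (poly E (cis \<theta>))"] by fastforce
  define F where "F w = (\<Prod>j<M. poly E (w * cis (2 * pi * real j / real M)))" for w
  have "norm (F 0) \<le> norm (poly E (cis \<theta>)) * B ^ (M - 1)"
  proof (rule maximum_modulus_frontier[where f = F and S = "cball 0 1" and \<xi> = 0])
    show "F holomorphic_on interior (cball 0 1)"
      unfolding F_def by (intro holomorphic_intros)
    show "continuous_on (closure (cball 0 1)) F"
      unfolding F_def by (intro continuous_intros)
  next
    fix w :: complex
    assume "w \<in> frontier (cball 0 1)"
    then have w: "norm w = 1"
      by simp
    obtain j \<theta>' where j: "j < M" and \<theta>': "\<bar>\<theta>'\<bar> \<le> pi / real M"
      and eq: "w * cis (2 * pi * real j / real M) = cis \<theta>'"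
      using unit_circle_covered_by_rotated_arcs[OF M w] by blast
    have "norm (F w) = norm (poly E (cis \<theta>')) *
        (\<Prod>i\<in>{..<M} - {j}. norm (poly E (w * cis (2 * pi * real i / real M))))"
      using j by (simp add: F_def norm_mult prod_norm eq prod.remove[of "{..<M}" j])
    \<comment> \<open>The other \<open>M - 1\<close> factors are at most \<open>B\<close>, since
      \<open>E\<close> and \<open>D\<close> have equal modulus on the circle.\<close>
    also have "\<dots> \<le> norm (poly E (cis \<theta>)) * (\<Prod>i\<in>{..<M} - {j}. B)"
      using w \<theta>' by (intro mult_mono prod_mono max prod_nonneg)
        (auto simp: norm_E norm_mult intro!: B)
    finally show "norm (F w) \<le> norm (poly E (cis \<theta>)) * B ^ (M - 1)"
      using j by simp
  qed auto
  \<comment> \<open>Every rotation fixes 0, so \<open>F 0\<close> is the \<open>M\<close>-th power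
    of \<open>poly E 0\<close>.\<close>
  moreover have "1 \<le> norm (F 0)"
    using E(2) by (simp add: F_def norm_power flip: prod_norm)
  ultimately show ?thesis
    using \<theta> by (intro exI[of _ \<theta>]) (auto simp: norm_E)
qed

section \<open>Statistics of a trace\<close>

definition ones_before :: "bool list \<Rightarrow> nat \<Rightarrow> nat" where
  "ones_before x z = card {i \<in> one_positions x. i < z}"

definition leading_ones :: "bool list \<Rightarrow> nat" where
  "leading_ones t = length (takeWhile id t)"

definition count_ones :: "bool list \<Rightarrow> nat" where
  "count_ones t = length (filter id t)"

lemma finite_positions [simp]: "finite (one_positions x)" "finite (zero_positions x)"
  by (auto simp: one_positions_def zero_positions_def)

lemma card_positions_le: "card (one_positions x) \<le> length x" "card (zero_positions x) \<le> length x"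
  using card_mono[of "{..<length x}" "one_positions x"] card_mono[of "{..<length x}" "zero_positions x"]
  by (auto simp: one_positions_def zero_positions_def)

lemma card_positions_add: "card (one_positions x) + card (zero_positions x) = length x"
proof -
  have "one_positions x \<union> zero_positions x = {..<length x}" "one_positions x \<inter> zero_positions x = {}"
    by (auto simp: one_positions_def zero_positions_def)
  then show ?thesis
    using card_Un_disjoint[of "one_positions x" "zero_positions x"] by simp
qed

lemma ones_before_le: "ones_before x z \<le> card (one_positions x)"
  unfolding ones_before_def by (intro card_mono) auto

lemma count_ones_nths: "count_ones (nths x I) = card (I \<inter> one_positions x)"
proof -
  have "count_ones (nths x I) = length (filter (\<lambda>p. fst p \<and> snd p \<in> I) (zip x [0..<length x]))"
    by (simp add: count_ones_def nths_def filter_map o_def conj_commute)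
  also have "\<dots> = card (I \<inter> one_positions x)"
    unfolding length_filter_conv_card
    by (intro arg_cong[of _ _ card]) (auto simp: one_positions_def)
  finally show ?thesis .
qed

text \<open>The kept 0 at \<open>z\<close> ends the initial run, and whatever is kept before it is a
  1.\<close>

lemma leading_ones_nths:
  assumes "z \<in> I" "z \<in> zero_positions x" "\<And>i. i \<in> I \<Longrightarrow> i < z \<Longrightarrow> x ! i"
  shows "leading_ones (nths x I) = card {i \<in> I. i < z}"
proof -
  have z: "z < length x" "\<not> x ! z"
    using assms(2) by (auto simp: zero_positions_def)
  have "nths x I = nths (take z x @ x ! z # drop (Suc z) x) I"
    using z(1) by (simp flip: id_take_nth_drop)
  also have "\<dots> = nths (take z x) I @ False # nths (drop (Suc z) x) {j. Suc j + z \<in> I}"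
    using z assms(1) by (simp add: nths_append nths_Cons)
  finally have eq: "nths x I = nths (take z x) I @ False # nths (drop (Suc z) x) {j. Suc j + z \<in> I}" .
  have "\<And>b. b \<in> set (nths (take z x) I) \<Longrightarrow> id b"
    using assms(3) by (auto simp: set_nths)
  then have "leading_ones (nths x I) = length (nths (take z x) I)"
    unfolding leading_ones_def eq by (subst takeWhile_append2) auto
  also have "\<dots> = card {i \<in> I. i < z}"
    unfolding length_nths using z(1) by (intro arg_cong[of _ _ card]) auto
  finally show ?thesis .
qed

lemma map_count_ones_channel:
  assumes "p \<in> {0..1}"
  shows "map_pmf count_ones (austere_channel p x) = binomial_pmf (card (one_positions x)) (1 - p)"
proof -
  have "map_pmf count_ones (austere_channel p x) =
      map_pmf (\<lambda>(Z, S). card S) (pair_pmf (retained_zeros x) (retained_ones p x))"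
    unfolding austere_channel_def pmf.map_comp
  proof (rule map_pmf_cong[OF refl], clarify)
    fix Z S
    assume "(Z, S) \<in> set_pmf (pair_pmf (retained_zeros x) (retained_ones p x))"
    then have "Z \<subseteq> zero_positions x" "S \<subseteq> one_positions x"
      by (auto simp: retained_zeros_def retained_ones_def split: if_splits)
    then have "(Z \<union> S) \<inter> one_positions x = S"
      by (auto simp: zero_positions_def one_positions_def)
    then show "(count_ones \<circ> (\<lambda>(Z, S). nths x (Z \<union> S))) (Z, S) = card S"
      by (simp add: count_ones_nths)
  qed
  also have "\<dots> = map_pmf card (map_pmf snd (pair_pmf (retained_zeros x) (retained_ones p x)))"
    by (simp add: pmf.map_comp o_def case_prod_unfold)
  also have "\<dots> = binomial_pmf (card (one_positions x)) (1 - p)"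
    unfolding map_snd_pair_pmf retained_ones_def pmf.map_comp o_def
    using assms by (subst binomial_pmf_altdef'[where A = "one_positions x" and dflt = False]) auto
  finally show ?thesis .
qed

text \<open>Given the retained position \<open>z\<close>, the leading run consists of the survivors
  among the 1s before \<open>z\<close>.\<close>

lemma map_leading_ones_channel:
  assumes "p \<in> {0..1}" and ne: "zero_positions x \<noteq> {}"
  shows "map_pmf leading_ones (austere_channel p x) =
     bind_pmf (pmf_of_set (zero_positions x)) (\<lambda>z. binomial_pmf (ones_before x z) (1 - p))"
proof -
  let ?keep = "\<lambda>A. Pi_pmf A False (\<lambda>_. bernoulli_pmf (1 - p))"
  have "map_pmf leading_ones (austere_channel p x) =
      bind_pmf (pmf_of_set (zero_positions x)) (\<lambda>z. map_pmf (\<lambda>keep.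
        leading_ones (nths x ({z} \<union> {i \<in> one_positions x. keep i}))) (?keep (one_positions x)))"
    using ne by (simp add: austere_channel_def retained_zeros_def retained_ones_def pair_pmf_def
        map_bind_pmf bind_map_pmf map_pmf_def bind_assoc_pmf bind_return_pmf)
  also have "\<dots> = bind_pmf (pmf_of_set (zero_positions x)) (\<lambda>z. binomial_pmf (ones_before x z) (1 - p))"
  proof (intro bind_pmf_cong refl)
    fix z
    assume "z \<in> set_pmf (pmf_of_set (zero_positions x))"
    then have z: "z \<in> zero_positions x"
      using ne by simp
    let ?A = "{i \<in> one_positions x. i < z}"
    have "leading_ones (nths x ({z} \<union> {i \<in> one_positions x. keep i})) = card {i \<in> ?A. keep i}" for keep
      using z by (subst leading_ones_nths[of z])
        (auto simp: one_positions_def intro!: arg_cong[of _ _ card])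
    then have "map_pmf (\<lambda>keep. leading_ones (nths x ({z} \<union> {i \<in> one_positions x. keep i})))
        (?keep (one_positions x)) = map_pmf (\<lambda>keep. card {i \<in> ?A. keep i}) (?keep (one_positions x))"
      by simp
    \<comment> \<open>Marginalises the product law to the coordinates before
      \<open>z\<close>.\<close>
    also have "\<dots> = map_pmf (\<lambda>keep. card {i \<in> ?A. keep i}) (?keep ?A)"
      by (subst Pi_pmf_subset[of "one_positions x" ?A])
        (auto simp: pmf.map_comp o_def intro!: map_pmf_cong arg_cong[of _ _ card])
    also have "\<dots> = binomial_pmf (ones_before x z) (1 - p)"
      using assms by (subst binomial_pmf_altdef'[where A = ?A and dflt = False])
        (auto simp: ones_before_def)
    finally show "map_pmf (\<lambda>keep. leading_ones (nths x ({z} \<union> {i \<in> one_positions x. keep i})))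
        (?keep (one_positions x)) = binomial_pmf (ones_before x z) (1 - p)" .
  qed
  finally show ?thesis .
qed

lemma set_austere_channel_subset:
  "set_pmf (austere_channel p x) \<subseteq> {t. set t \<subseteq> UNIV \<and> length t \<le> length x}"
proof -
  have "length (nths x I) \<le> length x" for I
    using card_mono[of "{..<length x}" "{i. i < length x \<and> i \<in> I}"] by (auto simp: length_nths)
  then show ?thesis
    by (auto simp: austere_channel_def)
qed

lemma finite_set_austere_channel: "finite (set_pmf (austere_channel p x))"
  by (rule finite_subset[OF set_austere_channel_subset finite_lists_length_le]) simp

lemma expectation_power_binomial_pmf:
  fixes s :: "'a :: {real_normed_field, banach, second_countable_topology}"
  assumes "q \<in> {0..1}"
  shows "measure_pmf.expectation (binomial_pmf n q) (\<lambda>i. s ^ i) = (1 - of_real q + of_real q * s) ^ n"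
proof -
  have "measure_pmf.expectation (binomial_pmf n q) (\<lambda>i. s ^ i)
      = (\<Sum>i\<le>n. pmf (binomial_pmf n q) i *\<^sub>R s ^ i)"
    using assms set_pmf_binomial_eq[of q n]
    by (intro integral_measure_pmf) (auto split: if_splits)
  also have "\<dots> = (\<Sum>i\<le>n. of_nat (n choose i) * (of_real q * s) ^ i * (1 - of_real q) ^ (n - i))"
    using assms by (intro sum.cong) (simp_all add: scaleR_conv_of_real power_mult_distrib mult_ac)
  also have "\<dots> = (of_real q * s + (1 - of_real q)) ^ n"
    by (simp add: binomial_ring)
  finally show ?thesis
    by (simp add: algebra_simps)
qed

text \<open>Averages the binomial generating functions over \<open>z\<close>. The general field
  covers both complex \<open>s\<close>, for the statistic, and the real number
  \<open>(norm s)\<^sup>2\<close>, for its second moment.\<close>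

lemma expectation_power_leading_ones:
  fixes s :: "'a :: {real_normed_field, banach, second_countable_topology}"
  assumes "p \<in> {0..1}" "zero_positions x \<noteq> {}"
  shows "measure_pmf.expectation (austere_channel p x) (\<lambda>t. s ^ leading_ones t) =
    (\<Sum>z\<in>zero_positions x. (of_real p + of_real (1 - p) * s) ^ ones_before x z)
      /\<^sub>R card (zero_positions x)"
proof -
  have "measure_pmf.expectation (austere_channel p x) (\<lambda>t. s ^ leading_ones t) =
      measure_pmf.expectation (map_pmf leading_ones (austere_channel p x)) (\<lambda>i. s ^ i)"
    by simp
  also have "\<dots> = (\<Sum>z\<in>zero_positions x. measure_pmf.expectation
      (binomial_pmf (ones_before x z) (1 - p)) (\<lambda>i. s ^ i) /\<^sub>R card (zero_positions x))"
    unfolding map_leading_ones_channel[OF assms]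
    using assms by (intro pmf_expectation_bind_pmf_of_set)
      (auto intro!: finite_subset[OF _ finite_atMost] simp: set_pmf_binomial_eq)
  finally show ?thesis
    using assms by (simp add: expectation_power_binomial_pmf scaleR_sum_right)
qed

lemma expectation_count_ones:
  assumes "p \<in> {0..1}"
  shows "measure_pmf.expectation (austere_channel p x) (\<lambda>t. real (count_ones t)) =
    real (card (one_positions x)) * (1 - p)"
proof -
  have "measure_pmf.expectation (austere_channel p x) (\<lambda>t. real (count_ones t)) =
      measure_pmf.expectation (map_pmf count_ones (austere_channel p x)) real"
    by simp
  also have "\<dots> = real (card (one_positions x)) * (1 - p)"
    unfolding map_count_ones_channel[OF assms]
    \<comment> \<open>The binomial mean is the first-moment identity for Bernstein
      polynomials.\<close>
    using assms sum_k_Bernstein[of "card (one_positions x)" "1 - p"]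
    by (simp add: expectation_binomial_pmf' Bernstein_def mult_ac)
  finally show ?thesis .
qed

section \<open>Separating the trace distributions of two strings\<close>

text \<open>The coefficient at \<open>i\<close> is the length of the possibly empty run of 0s
  preceded by exactly \<open>i\<close> 1s.\<close>

definition zeros_poly :: "bool list \<Rightarrow> complex poly" where
  "zeros_poly x = (\<Sum>z\<in>zero_positions x. monom 1 (ones_before x z))"

lemma positions_Cons:
  "one_positions (b # x) = (if b then {0} else {}) \<union> Suc ` one_positions x"
  "zero_positions (b # x) = (if b then {} else {0}) \<union> Suc ` zero_positions x"
  by (auto simp: one_positions_def zero_positions_def image_iff less_Suc_eq_0_disj)

lemma ones_before_Cons:
  "ones_before (b # x) 0 = 0"
  "ones_before (b # x) (Suc z) = (if b then Suc (ones_before x z) else ones_before x z)"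
proof -
  have "{i \<in> one_positions (b # x). i < Suc z} =
      (if b then {0} else {}) \<union> Suc ` {i \<in> one_positions x. i < z}"
    by (auto simp: positions_Cons)
  moreover have "card (insert 0 (Suc ` {i \<in> one_positions x. i < z})) =
      Suc (card {i \<in> one_positions x. i < z})"
    by (subst card_insert_disjoint) (auto simp: card_image)
  ultimately show "ones_before (b # x) (Suc z) = (if b then Suc (ones_before x z) else ones_before x z)"
    by (auto simp: ones_before_def card_image)
qed (simp add: ones_before_def)

lemma zeros_poly_Cons:
  "zeros_poly (False # x) = 1 + zeros_poly x"
  "zeros_poly (True # x) = pCons 0 (zeros_poly x)"
proof -
  show "zeros_poly (False # x) = 1 + zeros_poly x"
    unfolding zeros_poly_def positions_Cons
    by (subst sum.union_disjoint) (auto simp: sum.reindex ones_before_Cons)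
  have "monom 1 1 * zeros_poly x = zeros_poly (True # x)"
    unfolding zeros_poly_def positions_Cons sum_distrib_left
    by (simp add: sum.reindex ones_before_Cons mult_monom)
  then show "zeros_poly (True # x) = pCons 0 (zeros_poly x)"
    by (simp add: monom_altdef)
qed

lemma coeff_zeros_poly:
  "coeff (zeros_poly x) i = of_nat (card {z \<in> zero_positions x. ones_before x z = i})"
  by (simp add: zeros_poly_def coeff_sum flip: sum.inter_filter)

text \<open>The constant term reveals the first symbol: it is positive after a leading 0 and zero
  after a leading 1. Peeling symbols off gives the claim. Equal lengths matter because trailing 1s
  leave the polynomial unchanged.\<close>

lemma zeros_poly_inj:
  assumes "length x = length y" "zeros_poly x = zeros_poly y"
  shows "x = y"
proof -
  have *: "pCons 0 (zeros_poly x) \<noteq> 1 + zeros_poly y" for x y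
  proof
    assume "pCons 0 (zeros_poly x) = 1 + zeros_poly y"
    then have "coeff (pCons 0 (zeros_poly x)) 0 = coeff (1 + zeros_poly y) 0"
      by simp
    then have "(0::complex) = of_nat (Suc (card {z \<in> zero_positions y. ones_before y z = 0}))"
      by (simp add: coeff_zeros_poly)
    then show False
      by (simp only: of_nat_0_eq_iff)
  qed
  show ?thesis
    using assms
  proof (induction x y rule: list_induct2)
    case (Cons a x b y)
    then show ?case
      using *[of x y] *[of y x] by (cases a; cases b) (auto simp: zeros_poly_Cons)
  qed simp
qed

lemma poly_zeros_poly: "poly (zeros_poly x) u = (\<Sum>z\<in>zero_positions x. u ^ ones_before x z)"
  by (simp add: zeros_poly_def poly_sum poly_monom)

lemma norm_zeros_poly_le:
  assumes "norm u = 1"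
  shows "norm (poly (zeros_poly x) u) \<le> length x"
proof -
  have "norm (poly (zeros_poly x) u) \<le> (\<Sum>z\<in>zero_positions x. norm (u ^ ones_before x z))"
    unfolding poly_zeros_poly by (rule norm_sum)
  also have "\<dots> = card (zero_positions x)"
    using assms by (simp add: norm_power)
  finally show ?thesis
    using card_positions_le(2)[of x] by linarith
qed

text \<open>\<open>s\<close> is chosen so that thinning turns \<open>s\<close> into \<open>p + q s = cis \<theta>\<close>.\<close>

lemma second_moment_leading_ones:
  fixes \<theta> :: real
  assumes p: "p \<in> {0..<1}" and "zero_positions x \<noteq> {}"
  defines "s \<equiv> 1 + (cis \<theta> - 1) / of_real (1 - p)"
  shows "measure_pmf.expectation (austere_channel p x) (\<lambda>t. (norm (s ^ leading_ones t))\<^sup>2)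
    \<le> exp (card (one_positions x) * \<theta>\<^sup>2 / (1 - p))"
proof -
  define q where "q = 1 - p"
  have q: "0 < q" "q \<le> 1"
    using p by (auto simp: q_def)
  have "(norm s)\<^sup>2 = (1 + (cos \<theta> - 1) / q)\<^sup>2 + (sin \<theta> / q)\<^sup>2"
    by (simp add: s_def cmod_power2 flip: q_def)
  also have "\<dots> = (q\<^sup>2 + 2 * q * (cos \<theta> - 1) + ((cos \<theta>)\<^sup>2 + (sin \<theta>)\<^sup>2) + 1 - 2 * cos \<theta>) / q\<^sup>2"
    using q by (simp add: field_simps power2_eq_square)
  finally have s2: "(norm s)\<^sup>2 = (q\<^sup>2 + (2 - 2 * cos \<theta>) * (1 - q)) / q\<^sup>2"
    by (simp add: algebra_simps)
  \<comment> \<open>The base of the generating function at \<open>(norm s)\<^sup>2\<close>; its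
    excess over 1 turns out to be at most \<open>\<theta>\<^sup>2 / q\<close>.\<close>
  have "p + (1 - p) * (norm s)\<^sup>2 = 1 + (2 - 2 * cos \<theta>) * (1 - q) / q"
    using q unfolding s2 by (simp add: q_def[symmetric] field_simps power2_eq_square)
      (simp add: q_def algebra_simps)
  also have "\<dots> \<le> 1 + \<theta>\<^sup>2 * 1 / q"
  proof -
    have "(sin (\<theta> / 2))\<^sup>2 \<le> (\<theta> / 2)\<^sup>2"
      by (metis abs_sin_x_le_abs_x abs_le_square_iff)
    then have "2 - 2 * cos \<theta> \<le> \<theta>\<^sup>2"
      using cos_double_sin[of "\<theta> / 2"] by (simp add: power_divide)
    then have "(2 - 2 * cos \<theta>) * (1 - q) \<le> \<theta>\<^sup>2 * 1"
      using q by (intro mult_mono) auto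
    then show ?thesis
      using q by (intro add_left_mono divide_right_mono) auto
  qed
  also have "\<dots> \<le> exp (\<theta>\<^sup>2 / q)"
    using exp_ge_add_one_self[of "\<theta>\<^sup>2 / q"] by simp
  finally have base: "p + (1 - p) * (norm s)\<^sup>2 \<le> exp (\<theta>\<^sup>2 / q)" .
  have "(p + (1 - p) * (norm s)\<^sup>2) ^ ones_before x z \<le> exp (card (one_positions x) * \<theta>\<^sup>2 / q)" for z
  proof -
    have "(p + (1 - p) * (norm s)\<^sup>2) ^ ones_before x z \<le> exp (\<theta>\<^sup>2 / q) ^ ones_before x z"
      using base p by (intro power_mono) auto
    \<comment> \<open>The base is at least 1, so the exponent may grow to the total number of
      1s.\<close>
    also have "\<dots> \<le> exp (\<theta>\<^sup>2 / q) ^ card (one_positions x)"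
      using q by (intro power_increasing ones_before_le) auto
    finally show ?thesis
      by (simp flip: exp_of_nat_mult)
  qed
  then have "(\<Sum>z\<in>zero_positions x. (p + (1 - p) * (norm s)\<^sup>2) ^ ones_before x z) \<le>
      (\<Sum>z\<in>zero_positions x. exp (card (one_positions x) * \<theta>\<^sup>2 / q))"
    by (intro sum_mono)
  moreover have "card (zero_positions x) > 0"
    using assms(2) by (simp add: card_gt_0_iff)
  moreover have "measure_pmf.expectation (austere_channel p x) (\<lambda>t. (norm (s ^ leading_ones t))\<^sup>2) =
      (\<Sum>z\<in>zero_positions x. (p + (1 - p) * (norm s)\<^sup>2) ^ ones_before x z) / card (zero_positions x)"
    using expectation_power_leading_ones[of p x "(norm s)\<^sup>2"] p assms(2)
    by (simp add: norm_power divide_inverse mult.commute flip: power_mult)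
  ultimately show ?thesis
    unfolding q_def[symmetric] by (simp add: field_simps)
qed

text \<open>Equal lengths and equal numbers of 1s give a common number \<open>Z\<close> of 0s, so
  the expectation gap is an integer polynomial over \<open>Z\<close>. The arc bound costs
  \<open>M - 1\<close> factors \<open>2 * n\<close>, the division by \<open>Z\<close> at most one
  more, and the squared gap doubles the exponent.\<close>

lemma separation_same_number_of_ones:
  assumes p: "p \<in> {0..<1}" and M: "M > 0"
    and len: "length x = n" "length y = n"
    and ones: "card (one_positions x) = card (one_positions y)" "card (one_positions x) \<le> k"
    and neq: "x \<noteq> y"
  shows "\<exists>S. 1 \<le> 4 * (2 * real n) ^ (2 * M) * exp (k * (pi / real M)\<^sup>2 / (1 - p)) *
      (measure_pmf.prob (austere_channel p x) S - measure_pmf.prob (austere_channel p y) S)"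
proof -
  define Z where "Z = card (zero_positions x)"
  have Z: "card (zero_positions y) = Z" "Z \<le> n"
    using card_positions_add[of x] card_positions_add[of y] ones(1) len by (auto simp: Z_def)
  \<comment> \<open>Without 0s both polynomials are empty sums, forcing
    \<open>x = y\<close>.\<close>
  have "Z > 0"
  proof (rule ccontr)
    assume "\<not> Z > 0"
    then have "zero_positions x = {}" "zero_positions y = {}"
      using Z by (auto simp: Z_def)
    then have "zeros_poly x = zeros_poly y"
      by (simp add: zeros_poly_def)
    then show False
      using zeros_poly_inj len neq by metis
  qed
  then have ne: "zero_positions x \<noteq> {}" "zero_positions y \<noteq> {}"
    using Z by (auto simp: Z_def)
  define D where "D = zeros_poly x - zeros_poly y"
  have "D \<noteq> 0"
    using zeros_poly_inj len neq by (auto simp: D_def)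
  moreover have "coeff D i \<in> \<int>" for i
    by (simp add: D_def coeff_zeros_poly)
  moreover have "norm (poly D u) \<le> 2 * real n" if "norm u = 1" for u
    using norm_triangle_ineq4[of "poly (zeros_poly x) u" "poly (zeros_poly y) u"]
      norm_zeros_poly_le[OF that, of x] norm_zeros_poly_le[OF that, of y] len by (simp add: D_def)
  ultimately obtain \<theta> where \<theta>: "\<bar>\<theta>\<bar> \<le> pi / real M"
    and large: "1 \<le> norm (poly D (cis \<theta>)) * (2 * real n) ^ (M - 1)"
    using integer_poly_large_on_arc[of D M "2 * real n"] M by blast
  define s where "s = 1 + (cis \<theta> - 1) / of_real (1 - p)"
  define f where "f t = s ^ leading_ones t" for t
  let ?P = "austere_channel p x" and ?Q = "austere_channel p y"
  have "of_real p + of_real (1 - p) * s = cis \<theta>"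
    using p by (simp add: s_def distrib_left)
  then have E: "measure_pmf.expectation ?P f = poly (zeros_poly x) (cis \<theta>) /\<^sub>R Z"
    "measure_pmf.expectation ?Q f = poly (zeros_poly y) (cis \<theta>) /\<^sub>R Z"
    using expectation_power_leading_ones[of p x s] expectation_power_leading_ones[of p y s] p ne Z
    by (simp_all add: f_def[abs_def] poly_zeros_poly Z_def)
  have "measure_pmf.expectation ?P f - measure_pmf.expectation ?Q f = poly D (cis \<theta>) /\<^sub>R Z"
    unfolding E by (simp add: D_def scaleR_diff_right)
  then have gap: "norm (measure_pmf.expectation ?P f - measure_pmf.expectation ?Q f) = norm (poly D (cis \<theta>)) / Z"
    by (simp add: divide_inverse mult.commute)
  obtain S where S: "(norm (measure_pmf.expectation ?P f - measure_pmf.expectation ?Q f))\<^sup>2 \<le>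
     2 * (measure_pmf.expectation ?P (\<lambda>t. (norm (f t))\<^sup>2) + measure_pmf.expectation ?Q (\<lambda>t. (norm (f t))\<^sup>2))
       * (measure_pmf.prob ?P S - measure_pmf.prob ?Q S)" (is "_ \<le> 2 * (?VP + ?VQ) * ?d")
    using separating_set_from_expectation_gap[OF finite_set_austere_channel finite_set_austere_channel]
    by blast
  define V where "V = exp (k * (pi / real M)\<^sup>2 / (1 - p))"
  have V: "exp (j * \<theta>\<^sup>2 / (1 - p)) \<le> V" if "j \<le> k" for j
  proof -
    have "real j * \<theta>\<^sup>2 \<le> k * (pi / real M)\<^sup>2"
      using that \<theta> by (intro mult_mono) (auto simp flip: abs_le_square_iff)
    then show ?thesis
      using p by (simp add: V_def divide_right_mono)
  qed
  have "?VP \<le> V" "?VQ \<le> V"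
    using second_moment_leading_ones[of p x \<theta>] second_moment_leading_ones[of p y \<theta>] p ne ones
      V[of "card (one_positions x)"] by (auto simp: f_def s_def)
  have "1 \<le> (norm (poly D (cis \<theta>)) * (2 * real n) ^ (M - 1))\<^sup>2"
    using large by (simp add: one_le_power)
  \<comment> \<open>The additional factor \<open>2 * n\<close> absorbs the division by
    \<open>Z \<le> n\<close>.\<close>
  also have "\<dots> \<le> (norm (poly D (cis \<theta>)) / Z * (2 * real n) ^ M)\<^sup>2"
  proof -
    have "(2 * real n) ^ M = (2 * real n) * (2 * real n) ^ (M - 1)"
      using M by (cases M) auto
    then have "norm (poly D (cis \<theta>)) / Z * (2 * real n) ^ M =
        norm (poly D (cis \<theta>)) * (2 * real n) ^ (M - 1) * (2 * real n / Z)"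
      by simp
    moreover have "1 \<le> 2 * real n / Z"
      using Z \<open>Z > 0\<close> by simp
    then have "norm (poly D (cis \<theta>)) * (2 * real n) ^ (M - 1) * 1 \<le>
        norm (poly D (cis \<theta>)) * (2 * real n) ^ (M - 1) * (2 * real n / Z)"
      by (intro mult_left_mono) auto
    ultimately show ?thesis
      by (intro power_mono) auto
  qed
  also have "\<dots> = (norm (poly D (cis \<theta>)) / Z)\<^sup>2 * (2 * real n) ^ (2 * M)"
    by (subst power_mult_distrib) (simp only: mult.commute[of 2 M] power_mult)
  also have "\<dots> \<le> (2 * (?VP + ?VQ) * ?d) * (2 * real n) ^ (2 * M)"
    using S unfolding gap by (intro mult_right_mono) auto
  finally have main: "1 \<le> (2 * (?VP + ?VQ) * ?d) * (2 * real n) ^ (2 * M)" .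
  have "?VP + ?VQ \<ge> 0"
    by (intro add_nonneg_nonneg integral_nonneg) auto
  \<comment> \<open>The sign is needed before the second moments can be replaced by their upper
    bound \<open>V\<close>.\<close>
  then have "?d \<ge> 0"
    using main by (smt (verit) mult_nonneg_nonpos2 mult_nonneg_nonpos of_nat_0_le_iff zero_le_power)
  then have "(2 * (?VP + ?VQ) * ?d) * (2 * real n) ^ (2 * M) \<le> (2 * (V + V) * ?d) * (2 * real n) ^ (2 * M)"
    using \<open>?VP \<le> V\<close> \<open>?VQ \<le> V\<close> by (intro mult_right_mono mult_left_mono add_mono) auto
  with main show ?thesis
    unfolding V_def by (intro exI[of _ S]) (simp add: mult_ac)
qed

text \<open>The mean numbers of 1s differ by at least \<open>1 - p\<close>, being multiples of it by
  distinct integers, and the count is at most \<open>n\<close>.\<close>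

lemma separation_different_number_of_ones:
  assumes p: "p \<in> {0..<1}"
    and len: "length x = n" "length y = n"
    and ones: "card (one_positions x) \<noteq> card (one_positions y)"
  shows "\<exists>S. (1 - p)\<^sup>2 \<le> 4 * (real n)\<^sup>2 *
      (measure_pmf.prob (austere_channel p x) S - measure_pmf.prob (austere_channel p y) S)"
proof -
  let ?P = "austere_channel p x" and ?Q = "austere_channel p y"
  define f :: "bool list \<Rightarrow> complex" where "f t = of_real (real (count_ones t))" for t
  have second: "measure_pmf.expectation (austere_channel p w) (\<lambda>t. (norm (f t))\<^sup>2) \<le> (real n)\<^sup>2"
    if "length w = n" for w
  proof -
    have bound: "(norm (f t))\<^sup>2 \<le> (real n)\<^sup>2" if "t \<in> set_pmf (austere_channel p w)" for t
    proof -
      have "count_ones t \<le> length w"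
        using set_austere_channel_subset[of p w] that
        by (auto simp: count_ones_def intro: order.trans[OF length_filter_le])
      then show ?thesis
        using \<open>length w = n\<close> by (simp add: f_def)
    qed
    have "measure_pmf.expectation (austere_channel p w) (\<lambda>t. (norm (f t))\<^sup>2) \<le>
        measure_pmf.expectation (austere_channel p w) (\<lambda>t. (real n)\<^sup>2)"
      using bound by (intro integral_mono_AE integrable_measure_pmf_finite finite_set_austere_channel)
        (auto simp: AE_measure_pmf_iff)
    then show ?thesis
      by simp
  qed
  obtain S where S: "(norm (measure_pmf.expectation ?P f - measure_pmf.expectation ?Q f))\<^sup>2 \<le>
     2 * (measure_pmf.expectation ?P (\<lambda>t. (norm (f t))\<^sup>2) + measure_pmf.expectation ?Q (\<lambda>t. (norm (f t))\<^sup>2))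
       * (measure_pmf.prob ?P S - measure_pmf.prob ?Q S)" (is "_ \<le> 2 * (?VP + ?VQ) * ?d")
    using separating_set_from_expectation_gap[OF finite_set_austere_channel finite_set_austere_channel]
    by blast
  have E: "measure_pmf.expectation (austere_channel p w) f = of_real (card (one_positions w) * (1 - p))" for w
    unfolding f_def using expectation_count_ones[of p w] p by (simp only: integral_complex_of_real) simp
  define \<Delta> where "\<Delta> = real (card (one_positions x)) - real (card (one_positions y))"
  have "measure_pmf.expectation ?P f - measure_pmf.expectation ?Q f = of_real (\<Delta> * (1 - p))"
    unfolding E \<Delta>_def by (simp add: algebra_simps)
  then have gap: "norm (measure_pmf.expectation ?P f - measure_pmf.expectation ?Q f) = \<bar>\<Delta>\<bar> * (1 - p)"
    using p by (simp only: norm_of_real) (simp add: abs_mult)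
  have "\<bar>\<Delta>\<bar> \<ge> 1"
    using ones unfolding \<Delta>_def by linarith
  then have "1 * (1 - p) \<le> \<bar>\<Delta>\<bar> * (1 - p)"
    using p by (intro mult_right_mono) auto
  then have "(1 - p)\<^sup>2 \<le> (\<bar>\<Delta>\<bar> * (1 - p))\<^sup>2"
    using p by (intro power_mono) auto
  also have "\<dots> \<le> 2 * (?VP + ?VQ) * ?d"
    using S unfolding gap .
  finally have main: "(1 - p)\<^sup>2 \<le> 2 * (?VP + ?VQ) * ?d" .
  have "?VP + ?VQ \<ge> 0"
    by (intro add_nonneg_nonneg integral_nonneg) auto
  moreover have "(1 - p)\<^sup>2 > 0"
    using p by simp
  ultimately have "?d \<ge> 0"
    using main by (smt (verit) mult_nonneg_nonpos)
  then have "2 * (?VP + ?VQ) * ?d \<le> 2 * ((real n)\<^sup>2 + (real n)\<^sup>2) * ?d"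
    using second len by (intro mult_right_mono mult_left_mono add_mono) auto
  with main show ?thesis
    by (intro exI[of _ S]) (simp add: mult_ac)
qed

section \<open>Calibration of the arc length\<close>

text \<open>The arc \<open>\<bar>\<theta>\<bar> \<le> \<pi> / M\<close> costs a factor \<open>exp (O(M log n))\<close> in the gap and \<open>exp (O(k / (q M\<^sup>2)))\<close> in the
  second moments. These balance at \<open>M = X / log n\<close>, where \<open>X\<close> is the exponent below; the lower
  bound on \<open>q\<close> keeps this \<open>M\<close> bounded away from 0.\<close>

definition trace_exponent :: "real \<Rightarrow> real \<Rightarrow> nat \<Rightarrow> real" where
  "trace_exponent k q n = (k / q) powr (1/3) * ln (real n) powr (2/3)"

lemma ln_ge_1: "n \<ge> 3 \<Longrightarrow> ln (real n) \<ge> 1"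
  using exp_le by (subst ln_ge_iff) linarith+

text \<open>The cube identity is the balance of the two costs. The last two bounds absorb powers of
  \<open>n\<close> and of \<open>1 / q\<close> into a constant multiple of \<open>X\<close> in the
  exponent.\<close>

lemma trace_exponent_bounds:
  fixes k q c :: real
  assumes n: "n \<ge> 3" and k: "k \<ge> 1" and q: "0 < q" "q \<le> 1" and c: "c > 0"
    and qc: "q \<ge> c * sqrt (ln (real n) / k)"
  defines "X \<equiv> trace_exponent k q n"
  shows "X > 0" "X ^ 3 = k / q * (ln (real n))\<^sup>2" "c powr (2/3) * ln (real n) \<le> X" "1 / q\<^sup>2 \<le> exp (6 * X)"
proof -
  define l where "l = ln (real n)"
  have l: "l \<ge> 1"
    using ln_ge_1[OF n] by (simp add: l_def)
  show X: "X > 0"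
    using k q l by (simp add: X_def trace_exponent_def flip: l_def)
  have cube: "(a powr (i/3)) ^ 3 = a powr i" if "a > 0" for a i :: real
    using that by (simp add: powr_powr flip: powr_numeral)
  show X3: "X ^ 3 = k / q * (ln (real n))\<^sup>2"
    using k q l unfolding X_def trace_exponent_def power_mult_distrib
    by (simp add: cube flip: l_def)
  have "c\<^sup>2 * (l / k) = (c * sqrt (l / k))\<^sup>2"
    using k l by (simp add: power_mult_distrib)
  also have "\<dots> \<le> q\<^sup>2"
    using qc c k l unfolding l_def by (intro power_mono) auto
  \<comment> \<open>Crude, but it turns the hypothesis on \<open>q\<close> into
    \<open>c\<^sup>2 * l \<le> k / q\<close>, hence
    \<open>c\<^sup>2 * l ^ 3 \<le> X ^ 3\<close>.\<close>
  also have "q\<^sup>2 \<le> 1 / q"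
  proof -
    have "q ^ 3 \<le> 1"
      using q by (intro power_le_one) auto
    then show ?thesis
      using q by (simp add: field_simps power2_eq_square power3_eq_cube)
  qed
  finally have "c\<^sup>2 * l \<le> k / q"
    using k q by (simp add: field_simps)
  then have "c\<^sup>2 * l * l\<^sup>2 \<le> X ^ 3"
    unfolding X3 l_def by (intro mult_right_mono) auto
  moreover have "(c powr (2/3) * l) ^ 3 = c\<^sup>2 * l * l\<^sup>2"
    using c cube[of c 2] by (simp add: power_mult_distrib power2_eq_square power3_eq_cube)
  ultimately show "c powr (2/3) * ln (real n) \<le> X"
    using X power_mono_iff[of "c powr (2/3) * l" X 3] l unfolding l_def by simp
  \<comment> \<open>With this the cube identity yields \<open>1 / q \<le> X ^ 3\<close>, and
    \<open>X \<le> exp X\<close> finishes.\<close>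
  have "1 * 1 \<le> k * l\<^sup>2"
    using k l by (intro mult_mono one_le_power) auto
  have X_exp: "X \<le> exp X"
    using exp_ge_add_one_self[of X] by linarith
  have "1 / q \<le> X ^ 3"
    using q \<open>1 * 1 \<le> k * l\<^sup>2\<close> unfolding X3 by (simp add: l_def field_simps)
  then have "(1 / q)\<^sup>2 \<le> (X ^ 3)\<^sup>2"
    using q by (intro power_mono) auto
  also have "(X ^ 3)\<^sup>2 = X ^ 6"
    by (simp flip: power_mult)
  also have "\<dots> \<le> exp X ^ 6"
    using X X_exp by (intro power_mono) auto
  finally show "1 / q\<^sup>2 \<le> exp (6 * X)"
    by (simp add: power_divide flip: exp_of_nat_mult)
qed

lemma trace_distributions_separated:
  fixes k n :: nat and p c :: real
  assumes n: "n \<ge> 3" and k: "k \<ge> 1" and p: "p \<in> {0..<1}" and c: "c > 0"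
    and qc: "1 - p \<ge> c * sqrt (ln (real n) / real k)"
    and len: "length x = n" "length y = n"
    and ones: "card (one_positions x) \<le> k" "card (one_positions y) \<le> k"
    and neq: "x \<noteq> y"
  shows "\<exists>S. measure_pmf.prob (austere_channel p x) S - measure_pmf.prob (austere_channel p y) S
    \<ge> exp (- ((6 / c powr (2/3) + 20) * trace_exponent k (1 - p) n))"
proof -
  define q where "q = 1 - p"
  define X where "X = trace_exponent k q n"
  define l where "l = ln (real n)"
  define b where "b = c powr (2/3)"
  have q: "0 < q" "q \<le> 1"
    using p by (auto simp: q_def)
  have X: "X > 0" "X ^ 3 = k / q * l\<^sup>2" "b * l \<le> X" "1 / q\<^sup>2 \<le> exp (6 * X)"
    using trace_exponent_bounds[OF n _ q c] k qc by (auto simp: X_def l_def b_def q_def)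
  have "b > 0"
    using c by (simp add: b_def)
  then have lX: "6 * l \<le> 6 * X / b"
    using X(3) by (simp add: field_simps)
  have l: "l \<ge> 1"
    using ln_ge_1[OF n] by (simp add: l_def)
  have n_exp: "real n = exp l"
    using n by (simp add: l_def)
  have n2: "2 * real n \<le> exp (2 * l)" "4 \<le> exp (2 * l)"
  proof -
    have "exp (2 * l) = real n * real n"
      by (simp add: n_exp mult_exp_exp)
    moreover have "2 * real n \<le> real n * real n" "2 * 2 \<le> real n * real n"
      using n by (intro mult_mono; simp)+
    ultimately show "2 * real n \<le> exp (2 * l)" "4 \<le> exp (2 * l)"
      by simp_all
  qed
  \<comment> \<open>Common target of both cases: \<open>6 * l + 20 * X\<close> covers the cost of
    either, and \<open>b * l \<le> X\<close> merges its two terms.\<close>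
  have suffices: "exp (- ((6 / b + 20) * X)) \<le> d"
    if "1 \<le> A * d" "A \<le> exp (6 * l + 20 * X)" "A > 0" for A d :: real
  proof -
    have "d > 0"
      using that by (smt (verit) mult_nonneg_nonpos)
    then have "1 \<le> exp (6 * l + 20 * X) * d"
      using that mult_right_mono[of A "exp (6 * l + 20 * X)" d] by linarith
    also have "\<dots> \<le> exp ((6 / b + 20) * X) * d"
      using \<open>d > 0\<close> lX by (intro mult_right_mono) (simp_all add: algebra_simps)
    finally show ?thesis
      by (simp only: exp_minus inverse_eq_divide pos_divide_le_eq[OF exp_gt_zero] mult.commute)
  qed
  show ?thesis
  proof (cases "card (one_positions x) = card (one_positions y)")
    case False
    then obtain S where S: "q\<^sup>2 \<le> 4 * (real n)\<^sup>2 *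
        (measure_pmf.prob (austere_channel p x) S - measure_pmf.prob (austere_channel p y) S)"
      using separation_different_number_of_ones[OF p len] by (auto simp: q_def)
    have "4 * (real n)\<^sup>2 * (1 / q\<^sup>2) \<le> exp (2 * l) * exp (2 * l) * exp (6 * X)"
      using n2 X q by (intro mult_mono) (auto simp: n_exp simp flip: exp_of_nat_mult)
    also have "\<dots> \<le> exp (6 * l + 20 * X)"
      using l X by (simp flip: exp_add)
    finally have upper: "4 * (real n)\<^sup>2 * (1 / q\<^sup>2) \<le> exp (6 * l + 20 * X)" .
    have "1 \<le> 4 * (real n)\<^sup>2 * (1 / q\<^sup>2) *
        (measure_pmf.prob (austere_channel p x) S - measure_pmf.prob (austere_channel p y) S)"
      using S q by (simp add: field_simps)
    from suffices[OF this upper] show ?thesis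
      using n q unfolding X_def b_def q_def by (intro exI[of _ S]) simp
  next
    case True
    \<comment> \<open>The balancing value, rounded up to a positive integer; the rounding costs at
      most one extra \<open>l\<close> in \<open>M * l\<close>.\<close>
    define M where "M = nat \<lceil>X / l\<rceil>"
    have "X / l > 0"
      using X l by simp
    then have M: "M > 0" "X / l \<le> real M" "real M \<le> X / l + 1"
      unfolding M_def by linarith+
    obtain S where S: "1 \<le> 4 * (2 * real n) ^ (2 * M) * exp (k * (pi / real M)\<^sup>2 / q) *
        (measure_pmf.prob (austere_channel p x) S - measure_pmf.prob (austere_channel p y) S)"
      using separation_same_number_of_ones[OF p M(1) len True ones(1) neq] by (auto simp: q_def)
    have "(2 * real n) ^ (2 * M) \<le> exp (2 * l) ^ (2 * M)"
      using n2 by (intro power_mono) auto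
    also have "\<dots> = exp (4 * (real M * l))"
      by (simp flip: exp_of_nat_mult)
    also have "\<dots> \<le> exp (4 * (X + l))"
      using mult_right_mono[OF M(3), of l] l by (simp add: distrib_right)
    finally have 1: "(2 * real n) ^ (2 * M) \<le> exp (4 * (X + l))" .
    \<comment> \<open>From \<open>pi < 4\<close> and \<open>M \<ge> X / l\<close> the exponent is at
      most \<open>16 * X ^ 3 / X\<^sup>2\<close>.\<close>
    have "k * (pi / real M)\<^sup>2 / q \<le> k * (4 / (X / l))\<^sup>2 / q"
      using M pi_less_4 q \<open>X / l > 0\<close>
      by (intro divide_right_mono mult_left_mono power_mono frac_le) auto
    also have "\<dots> = 16 * (k / q * l\<^sup>2) / X\<^sup>2"
      by (simp add: power_divide power_mult_distrib mult_ac)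
    also have "\<dots> = 16 * X"
      using X(1) unfolding X(2)[symmetric] by (simp add: power2_eq_square power3_eq_cube)
    finally have 2: "exp (k * (pi / real M)\<^sup>2 / q) \<le> exp (16 * X)"
      by simp
    have "4 * (2 * real n) ^ (2 * M) * exp (k * (pi / real M)\<^sup>2 / q) \<le>
        exp (2 * l) * exp (4 * (X + l)) * exp (16 * X)"
      using n2 1 2 by (intro mult_mono) auto
    also have "\<dots> = exp (6 * l + 20 * X)"
      by (simp add: algebra_simps flip: exp_add)
    finally show ?thesis
      using suffices[OF S] n unfolding X_def b_def q_def by (intro exI[of _ S]) simp
  qed
qed

section \<open>From separated trace distributions to the number of traces\<close>

theorem theorem6:
  fixes c :: real
  assumes "c > 0"
  shows "\<exists>C>0. \<exists>\<delta> :: nat \<Rightarrow> real. \<delta> \<longlonglongrightarrow> 0 \<and>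
    (\<forall>(n::nat) (k::nat) (p\<^sub>1::real) (q\<^sub>1::real) (m::nat).
       k \<ge> 1 \<and> 0 \<le> p\<^sub>1 \<and> p\<^sub>1 \<le> 1 \<and> q\<^sub>1 = 1 - p\<^sub>1 \<and>
       q\<^sub>1 \<ge> c * sqrt (ln (real n) / real k) \<and>
       real m \<ge> exp (C * ((real k / q\<^sub>1) powr (1/3) * ln (real n) powr (2/3)))
       \<longrightarrow> (\<exists>reconstruct :: bool list list \<Rightarrow> bool list.
             \<forall>x :: bool list. length x = n \<and> card (one_positions x) \<le> k \<longrightarrow>
               measure_pmf.prob (austere_traces m p\<^sub>1 x) {ts. reconstruct ts = x} \<ge> 1 - \<delta> n))"
proof -
  define b where "b = c powr (2/3)"
  define K where "K = 6 / b + 20"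
  \<comment> \<open>Chosen so that \<open>m\<close> times the squared gap
    \<open>exp (- (2 * K * X))\<close> is at least \<open>exp (3 * X / b)\<close>, hence at least
    \<open>n ^ 3\<close>.\<close>
  define C where "C = 2 * K + 3 / b"
  \<comment> \<open>The union bound has at most \<open>(2 ^ n)\<^sup>2\<close> terms, which
    \<open>exp (- (n ^ 3) / 2)\<close> outweighs. For \<open>n < 3\<close> the value 1 makes the
    claim trivial.\<close>
  define \<delta> where "\<delta> n = (if n < 3 then 1 else 2 * (2 ^ n)\<^sup>2 * exp (- (real n ^ 3) / 2))" for n :: nat
  have "b > 0"
    using assms by (simp add: b_def)
  then have "C > 0"
    by (simp add: C_def K_def add_pos_pos)
  have "(\<lambda>n. 2 * (2 ^ n)\<^sup>2 * exp (- (real n ^ 3) / 2)) \<longlonglongrightarrow> (0::real)"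
    by real_asymp
  moreover have "eventually (\<lambda>n. 2 * (2 ^ n)\<^sup>2 * exp (- (real n ^ 3) / 2) = \<delta> n) sequentially"
    using eventually_ge_at_top[of 3] by eventually_elim (simp add: \<delta>_def)
  ultimately have \<delta>: "\<delta> \<longlonglongrightarrow> 0"
    by (rule Lim_transform_eventually)
  have "\<exists>reconstruct. \<forall>x. length x = n \<and> card (one_positions x) \<le> k \<longrightarrow>
           measure_pmf.prob (austere_traces m p x) {ts. reconstruct ts = x} \<ge> 1 - \<delta> n"
    if k: "k \<ge> 1" and p: "0 \<le> p" "p \<le> 1" and q: "1 - p \<ge> c * sqrt (ln (real n) / real k)"
      and m: "real m \<ge> exp (C * trace_exponent k (1 - p) n)"
    for n k m :: nat and p :: real
  proof (cases "n < 3")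
    case True
    then show ?thesis
      by (simp add: \<delta>_def)
  next
    case False
    then have n: "n \<ge> 3"
      by simp
    define l where "l = ln (real n)"
    \<comment> \<open>Positivity of the lower bound on \<open>1 - p\<close> excludes
      \<open>p = 1\<close>, where every 1 is lost.\<close>
    have "0 < c * sqrt (l / real k)"
      using ln_ge_1[OF n] assms k by (simp add: l_def)
    then have p': "p \<in> {0..<1}"
      using q p by (simp add: l_def)
    define X where "X = trace_exponent k (1 - p) n"
    define \<epsilon> where "\<epsilon> = exp (- (K * X))"
    define A where "A = {x. length x = n \<and> card (one_positions x) \<le> k}"
    have A: "finite A" "card A \<le> 2 ^ n"
    proof -
      have "A \<subseteq> {x. set x \<subseteq> UNIV \<and> length x = n}"
        by (auto simp: A_def)
      then show "finite A" "card A \<le> 2 ^ n"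
        using finite_subset[OF _ finite_lists_length_eq[of "UNIV :: bool set" n]]
          card_mono[OF finite_lists_length_eq[of "UNIV :: bool set" n]]
          card_lists_length_eq[of "UNIV :: bool set" n]
        by auto
    qed
    have "b * l \<le> X"
      using trace_exponent_bounds(3)[OF n _ _ _ assms, of k "1 - p"] k p' q
      by (simp add: X_def b_def l_def)
    then have "3 * l \<le> 3 * X / b"
      using \<open>b > 0\<close> by (simp add: field_simps)
    have "real n ^ 3 = exp l ^ 3"
      using n by (simp add: l_def)
    also have "\<dots> = exp (3 * l)"
      by (simp flip: exp_of_nat_mult)
    also have "\<dots> \<le> exp (C * X - 2 * (K * X))"
      using \<open>3 * l \<le> 3 * X / b\<close> by (simp add: C_def algebra_simps)
    also have "\<dots> = exp (C * X) * \<epsilon>\<^sup>2"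
      by (simp add: \<epsilon>_def exp_diff exp_minus power_inverse divide_inverse flip: exp_of_nat_mult)
    also have "\<dots> \<le> real m * \<epsilon>\<^sup>2"
      using m by (intro mult_right_mono) (auto simp: X_def)
    finally have m\<epsilon>: "real n ^ 3 \<le> real m * \<epsilon>\<^sup>2" .
    have "real m > 0"
      using m exp_gt_zero[of "C * trace_exponent k (1 - p) n"] by linarith
    then have "m > 0"
      by simp
    have "\<epsilon> > 0"
      by (simp add: \<epsilon>_def)
    have sep: "\<exists>S. measure_pmf.prob (austere_channel p x) S - measure_pmf.prob (austere_channel p y) S \<ge> \<epsilon>"
      if "x \<in> A" "y \<in> A" "x \<noteq> y" for x y
      using trace_distributions_separated[OF n k p' assms q _ _ _ _ that(3)] that(1,2)
      by (auto simp: A_def \<epsilon>_def K_def b_def X_def)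
    obtain g where g: "\<And>x. x \<in> A \<Longrightarrow> measure_pmf.prob (replicate_pmf m (austere_channel p x)) {ts. g ts = x}
        \<ge> 1 - 2 * real (card A)^2 * exp (- real m * \<epsilon>\<^sup>2 / 2)"
      using exists_identification_from_samples[OF A(1) \<open>m > 0\<close> \<open>\<epsilon> > 0\<close>, of "austere_channel p"] sep
      by blast
    have "real (card A) \<le> 2 ^ n"
      using A(2) by (metis of_nat_le_iff of_nat_numeral of_nat_power)
    then have "2 * real (card A)^2 * exp (- real m * \<epsilon>\<^sup>2 / 2) \<le> 2 * (2 ^ n)\<^sup>2 * exp (- (real n ^ 3) / 2)"
      using m\<epsilon> by (intro mult_mono power_mono) auto
    then have "2 * real (card A)^2 * exp (- real m * \<epsilon>\<^sup>2 / 2) \<le> \<delta> n"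
      using n by (simp add: \<delta>_def)
    then show ?thesis
      using g unfolding austere_traces_def A_def by (intro exI[of _ g]) force
  qed
  then show ?thesis
    using \<open>C > 0\<close> \<delta> unfolding trace_exponent_def by blast
qed

end
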